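(* Let $n\ge2$, $L$ and $K_2>K>100K_1$ be positive integers. Let $G$ be an $n$-vertex graph satisfying the following two properties: (L1) For every integer $3\le\ell\le L$ there are no subgraphs $H,C\subseteq G$ such that $H$ is connected, $C$ is an $\ell$-cycle, $|V(H)|\in[K_1\ell\ln n,\,K_2\ell\ln n]$, and $H$ activates $C$ in $G$ via a nice activation process. (L2) For every integer $4\le\ell\le L$ there is an $\ell$-cycle $C\subseteq G$ such that no connected $H\subseteq G$ with $|V(H)|\in[\ell,\,K\ell\ln n]$ activates $C$ in $G$ via a nice activation process. Then there is no tree $T\subseteq G$ with diameter at most $L/100$ activating $G$.
   Context: All graphs are finite and simple. An activation process in a graph $G$ is a tuple $\mathbf{A}=(H;\Delta_1,\dots,\Delta_s)$, where $H\subseteq G$ is a subgraph and $\Delta_1,\dots,\Delta_s$ are triangles of $G$, such that, putting $H_0=H$ and $H_i=H_{i-1}\cup\Delta_i$, for every $i$ the graph $H_i$ is obtained from $H_{i-1}$ by adding exactly one edge $e_i$ (and no vertex); thus $e_i\in\Delta_i$ and the other two edges of $\Delta_i$ are in $H_{i-1}$. We say that $\Delta_i$ activates $e_i$. For a graph $G'\subseteq H_s$, we say that $H$ activates $G'$ in $G$ via $\mathbf{A}$. A tree $T\subseteq G$ activates $G$ if $T$ is a spanning tree of $G$ and there is an activation process in $G$ starting from $T$ whose final graph is $H_s=G$. Let $H$ activate $G'$ in $G$ via $\mathbf{A}=(H;\Delta_1,\dots,\Delta_s)$. For an edge $e$ of $H\cup\Delta_1\cup\dots\cup\Delta_s$,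 its contribution is $$\mathrm{con}_{\mathbf{A}}(e)=|\{i: e\subseteq\Delta_i \text{ and } \Delta_i\text{ does not activate }e\}|,$$ and its excess is $\mathrm{exc}_{\mathbf{A}}(e)=\mathrm{con}_{\mathbf{A}}(e)$ if $e\in E(G')\setminus E(H)$; $\mathrm{exc}_{\mathbf{A}}(e)=\mathrm{con}_{\mathbf{A}}(e)-1$ if $e\notin E(G')\triangle E(H)$; and $\mathrm{exc}_{\mathbf{A}}(e)=\mathrm{con}_{\mathbf{A}}(e)-2$ if $e\in E(H)\setminus E(G')$. The process $\mathbf{A}$ (activating $G'$) is nice if every edge of $H\cup\Delta_1\cup\dots\cup\Delta_s$ has non-negative excess. *)

theory Defs
  imports Complex_Main
begin

datatype 'a ugraph = Graph (verts: "'a set") (edges: "'a set set")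

definition simple_graph :: "'a ugraph \<Rightarrow> bool" where
  "simple_graph G \<longleftrightarrow> finite (verts G) \<and> (\<forall>e \<in> edges G. e \<subseteq> verts G \<and> card e = 2)"

definition subgraph :: "'a ugraph \<Rightarrow> 'a ugraph \<Rightarrow> bool" where
  "subgraph H G \<longleftrightarrow> simple_graph H \<and> verts H \<subseteq> verts G \<and> edges H \<subseteq> edges G"

definition graph_union :: "'a ugraph \<Rightarrow> 'a ugraph \<Rightarrow> 'a ugraph" where
  "graph_union G H = Graph (verts G \<union> verts H) (edges G \<union> edges H)"

definition adj_rel :: "'a ugraph \<Rightarrow> ('a \<times> 'a) set" where
  "adj_rel G = {(u, v). {u, v} \<in> edges G}"

definition connected_graph :: "'a ugraph \<Rightarrow> bool" where
  "connected_graph G \<longleftrightarrow>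
     verts G \<noteq> {} \<and> (\<forall>u \<in> verts G. \<forall>v \<in> verts G. (u, v) \<in> (adj_rel G)\<^sup>*)"

definition is_cycle :: "nat \<Rightarrow> 'a ugraph \<Rightarrow> bool" where
  "is_cycle l C \<longleftrightarrow> l \<ge> 3 \<and>
     (\<exists>vs. distinct vs \<and> length vs = l \<and> verts C = set vs \<and>
        edges C = {{vs ! i, vs ! (Suc i mod l)} | i. i < l})"

definition is_tree :: "'a ugraph \<Rightarrow> bool" where
  "is_tree T \<longleftrightarrow> simple_graph T \<and> connected_graph T \<and> (\<nexists>l C. is_cycle l C \<and> subgraph C T)"

definition spanning_tree :: "'a ugraph \<Rightarrow> 'a ugraph \<Rightarrow> bool" where
  "spanning_tree T G \<longleftrightarrow> is_tree T \<and> subgraph T G \<and> verts T = verts G"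

text \<open>A pair lies in the \<open>k\<close>-th relational power of the adjacency relation iff its components
  are joined by a walk of length \<open>k\<close>. Distance and diameter are only meaningful for finite
  connected graphs.\<close>

definition graph_dist :: "'a ugraph \<Rightarrow> 'a \<Rightarrow> 'a \<Rightarrow> nat" where
  "graph_dist G u v = (LEAST k. (u, v) \<in> adj_rel G ^^ k)"

definition graph_diameter :: "'a ugraph \<Rightarrow> nat" where
  "graph_diameter G = Max {graph_dist G u v | u v. u \<in> verts G \<and> v \<in> verts G}"

text \<open>\<open>stage H Ds i\<close> is the graph \<open>H\<^sub>i\<close>. The triangles are kept in a list indexed from 0, so
  \<open>Ds ! i\<close> is the triangle leading from \<open>H\<^sub>i\<close> to the graph with index \<open>i + 1\<close>.\<close>

definition stage :: "'a ugraph \<Rightarrow> 'a ugraph list \<Rightarrow> nat \<Rightarrow> 'a ugraph" where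
  "stage H Ds i = foldl graph_union H (take i Ds)"

definition final_graph :: "'a ugraph \<Rightarrow> 'a ugraph list \<Rightarrow> 'a ugraph" where
  "final_graph H Ds = stage H Ds (length Ds)"

definition activation_process :: "'a ugraph \<Rightarrow> 'a ugraph \<Rightarrow> 'a ugraph list \<Rightarrow> bool" where
  "activation_process G H Ds \<longleftrightarrow>
     subgraph H G \<and>
     (\<forall>D \<in> set Ds. is_cycle 3 D \<and> subgraph D G) \<and>
     (\<forall>i < length Ds.
        verts (stage H Ds (Suc i)) = verts (stage H Ds i) \<and>
        (\<exists>e. e \<notin> edges (stage H Ds i) \<and>
             edges (stage H Ds (Suc i)) = insert e (edges (stage H Ds i))))"

definition activates_edge :: "'a ugraph \<Rightarrow> 'a ugraph list \<Rightarrow> nat \<Rightarrow> 'a set \<Rightarrow> bool" where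
  "activates_edge H Ds i e \<longleftrightarrow> e \<in> edges (stage H Ds (Suc i)) \<and> e \<notin> edges (stage H Ds i)"

definition activates_via :: "'a ugraph \<Rightarrow> 'a ugraph \<Rightarrow> 'a ugraph \<Rightarrow> 'a ugraph list \<Rightarrow> bool" where
  "activates_via G H G' Ds \<longleftrightarrow> activation_process G H Ds \<and> subgraph G' (final_graph H Ds)"

definition con :: "'a ugraph \<Rightarrow> 'a ugraph list \<Rightarrow> 'a set \<Rightarrow> nat" where
  "con H Ds e = card {i. i < length Ds \<and> e \<in> edges (Ds ! i) \<and> \<not> activates_edge H Ds i e}"

definition exc :: "'a ugraph \<Rightarrow> 'a ugraph \<Rightarrow> 'a ugraph list \<Rightarrow> 'a set \<Rightarrow> int" where
  "exc H G' Ds e =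
     (if e \<in> edges G' - edges H then int (con H Ds e)
      else if e \<in> edges H - edges G' then int (con H Ds e) - 2
      else int (con H Ds e) - 1)"

definition nice :: "'a ugraph \<Rightarrow> 'a ugraph \<Rightarrow> 'a ugraph list \<Rightarrow> bool" where
  "nice H G' Ds \<longleftrightarrow> (\<forall>e \<in> edges (final_graph H Ds). exc H G' Ds e \<ge> 0)"

definition activates_nicely :: "'a ugraph \<Rightarrow> 'a ugraph \<Rightarrow> 'a ugraph \<Rightarrow> bool" where
  "activates_nicely G H G' \<longleftrightarrow> (\<exists>Ds. activates_via G H G' Ds \<and> nice H G' Ds)"

definition tree_activates :: "'a ugraph \<Rightarrow> 'a ugraph \<Rightarrow> bool" where
  "tree_activates T G \<longleftrightarrow>
     spanning_tree T G \<and> (\<exists>Ds. activation_process G T Ds \<and> final_graph T Ds = G)"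

end

theory Submission imports Defs begin

text \<open>Suppose a tree \<open>T\<close> of diameter \<open>D\<close> with \<open>100 D \<le> L\<close> activates \<open>G\<close>. The triangles of the process
  behave like the triangles of a simply connected complex. An edge set of \<open>G\<close> with all degrees even
  (an \<^emph>\<open>even\<close> set) is the boundary modulo 2 of some set \<open>S\<close> of these triangles, a \<^emph>\<open>filling\<close>:
  going back through the process, adding triangles removes the activated edges one after the other,
  and \<open>T\<close> contains no nonempty even set. Conversely, no earlier triangle contains the edge that a
  triangle activates, so a nonempty set of triangles never has empty boundary.

  Niceness has a simple meaning in this picture. Any set \<open>S\<close> of triangles of the process, taken in
  the original order, is itself an activation process, starting from the edges of \<open>S\<close> that are not
  activated within \<open>S\<close> (\<open>seed S\<close>). An edge lying in \<open>d\<close> triangles of \<open>S\<close> has contribution \<open>d\<close> if it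
  belongs to the seed and \<open>d - 1\<close> otherwise, so for a cycle \<open>C\<close> the process is nice as soon as every
  edge outside \<open>C\<close> has \<open>d \<ge> 2\<close>. If \<open>C\<close> is the boundary of \<open>S\<close>, then \<open>d\<close> is odd on \<open>C\<close> and even
  elsewhere, and niceness is automatic (\<open>seed_activates_nicely\<close>). The seed is connected because a
  component that misses \<open>C\<close> would have empty boundary (\<open>seed_connected\<close>). Hence (L1) becomes a gap: a
  filling of an \<open>l\<close>-cycle with \<open>l \<le> L\<close> never spans between \<open>K1 l ln n\<close> and \<open>K2 l ln n\<close> vertices.

  The advantage of fillings over activation processes is that they add up: the symmetric difference
  of fillings of \<open>E\<close> and \<open>F\<close> fills the symmetric difference of \<open>E\<close> and \<open>F\<close>, and it spans at most as
  many vertices as the two together. With \<open>c = K1 ln n\<close>, this gives by induction along the process that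
  every even set \<open>E\<close> of at most \<open>2 D + 2\<close> edges has a filling on at most \<open>c |E|\<close> vertices
  (\<open>even_sets_fillable\<close>). Since even sets decompose into cycles, it suffices to treat a cycle \<open>C\<close> of
  length \<open>l\<close> through the edge that has just been activated. Adding the last triangle to \<open>C\<close> removes
  this edge and increases the length by at most one. If \<open>l < 2 D + 2\<close>, the result falls under the
  induction hypothesis. If \<open>l = 2 D + 2\<close>, then \<open>C\<close> is first cut into two shorter even sets along a path
  of \<open>T\<close>. Either way \<open>C\<close> has a filling on at most \<open>2 c l + 3\<close> vertices; this is below the upper end of
  the gap, hence the filling spans fewer than \<open>c l\<close> vertices.

  In particular every 4-cycle of \<open>G\<close> is nicely activated by a connected graph on at least 4 and at
  most \<open>4 K1 ln n\<close> vertices, and this contradicts (L2) for cycles of length 4.\<close>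

section \<open>Sums modulo 2\<close>

definition mod2_sum :: "('i \<Rightarrow> 'b set) \<Rightarrow> 'i set \<Rightarrow> 'b set" where
  "mod2_sum f S = {x. odd (card {i \<in> S. x \<in> f i})}"

abbreviation vertex_boundary :: "'a set set \<Rightarrow> 'a set" where
  "vertex_boundary E \<equiv> mod2_sum (\<lambda>e. e) E"

lemma mod2_sum_empty [simp]: "mod2_sum f {} = {}"
  by (simp add: mod2_sum_def)

lemma mod2_sum_singleton [simp]: "mod2_sum f {i} = f i"
proof -
  have "{j. j = i \<and> x \<in> f j} = (if x \<in> f i then {i} else {})" for x
    by auto
  then show ?thesis
    by (auto simp: mod2_sum_def split: if_splits)
qed

lemma mod2_sum_sym_diff:
  assumes "finite A" "finite B"
  shows "mod2_sum f (sym_diff A B) = sym_diff (mod2_sum f A) (mod2_sum f B)"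
proof -
  have "odd (card {i \<in> sym_diff A B. x \<in> f i}) \<longleftrightarrow>
        odd (card {i \<in> A. x \<in> f i}) \<noteq> odd (card {i \<in> B. x \<in> f i})" for x
  proof -
    let ?P = "{i \<in> A - B. x \<in> f i}" and ?Q = "{i \<in> B - A. x \<in> f i}"
    let ?R = "{i \<in> A \<inter> B. x \<in> f i}"
    have "card (?P \<union> ?R) = card ?P + card ?R" "card (?Q \<union> ?R) = card ?Q + card ?R"
      "card (?P \<union> ?Q) = card ?P + card ?Q"
      using assms by (auto intro!: card_Un_disjoint)
    moreover have "?P \<union> ?R = {i \<in> A. x \<in> f i}" "?Q \<union> ?R = {i \<in> B. x \<in> f i}"
      "?P \<union> ?Q = {i \<in> sym_diff A B. x \<in> f i}"
      by auto
    ultimately show ?thesis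
      by (metis (no_types, lifting) even_add)
  qed
  then show ?thesis
    unfolding mod2_sum_def by blast
qed

lemma mod2_sum_subset: "mod2_sum f S \<subseteq> (\<Union>i\<in>S. f i)"
proof
  fix x assume "x \<in> mod2_sum f S"
  then have "{i \<in> S. x \<in> f i} \<noteq> {}"
    unfolding mod2_sum_def by (metis (no_types, lifting) card.empty even_zero mem_Collect_eq)
  then show "x \<in> (\<Union>i\<in>S. f i)" by blast
qed

lemma card_sym_diff_le:
  assumes "finite A" "finite B"
  shows "card (sym_diff A B) \<le> card A + card B"
proof -
  have "card (sym_diff A B) \<le> card (A \<union> B)"
    using assms by (intro card_mono) auto
  also have "\<dots> \<le> card A + card B"
    by (rule card_Un_le)
  finally show ?thesis .
qed

section \<open>Cycles and edge sets with empty boundary\<close>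

text \<open>Rotating the vertex list of a cycle makes a prescribed edge the closing one, so that the remaining
  edges form a path whose indices need no reduction modulo \<open>l\<close>.\<close>

lemma cycle_starting_after_edge:
  assumes "is_cycle l C" "e \<in> edges C"
  obtains vs where "distinct vs" "length vs = l" "verts C = set vs" "e = {vs ! (l - 1), vs ! 0}"
    "edges C = insert e {{vs ! i, vs ! Suc i} |i. i < l - 1}"
proof -
  from assms(1) obtain us where l: "l \<ge> 3" and us: "distinct us" "length us = l" "verts C = set us"
    and E: "edges C = {{us ! i, us ! (Suc i mod l)} | i. i < l}"
    unfolding is_cycle_def by blast
  from assms(2) E obtain j where j: "j < l" "e = {us ! j, us ! (Suc j mod l)}" by blast
  define vs where "vs = rotate (Suc j) us"
  have nth: "vs ! i = us ! ((Suc j + i) mod l)" if "i < l" for i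
    unfolding vs_def using that us by (simp only: nth_rotate)
  have edge: "{vs ! i, vs ! (Suc i mod l)} = {us ! ((Suc j + i) mod l), us ! (Suc ((Suc j + i) mod l) mod l)}"
    if "i < l" for i
  proof -
    have "Suc i mod l < l" using l by simp
    moreover have "(Suc j + Suc i mod l) mod l = Suc ((Suc j + i) mod l) mod l"
      by (metis add_Suc_right mod_Suc_eq mod_add_right_eq)
    ultimately show ?thesis using nth[OF that] nth[of "Suc i mod l"] by simp
  qed
  have shift: "\<exists>i<l. (Suc j + i) mod l = k" if "k < l" for k
  proof (intro exI[of _ "(k + (l - Suc j)) mod l"] conjI)
    have "(Suc j + (k + (l - Suc j)) mod l) mod l = (Suc j + (k + (l - Suc j))) mod l"
      by (simp only: mod_add_right_eq)
    also have "Suc j + (k + (l - Suc j)) = k + l" using j(1) by simp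
    also have "(k + l) mod l = k" using that by simp
    finally show "(Suc j + (k + (l - Suc j)) mod l) mod l = k" .
  qed (use l in simp)
  have E': "edges C = {{vs ! i, vs ! (Suc i mod l)} | i. i < l}"
  proof (intro equalityI subsetI)
    fix x assume "x \<in> edges C"
    then obtain k where k: "k < l" "x = {us ! k, us ! (Suc k mod l)}" using E by blast
    obtain i where i: "i < l" "(Suc j + i) mod l = k" using shift[OF k(1)] by blast
    then have "x = {vs ! i, vs ! (Suc i mod l)}" using edge[OF i(1)] k(2) by simp
    with i(1) show "x \<in> {{vs ! i, vs ! (Suc i mod l)} | i. i < l}" by blast
  next
    fix x assume "x \<in> {{vs ! i, vs ! (Suc i mod l)} | i. i < l}"
    then obtain i where i: "i < l" "x = {vs ! i, vs ! (Suc i mod l)}" by blast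
    have "(Suc j + i) mod l < l" using l by simp
    moreover have "x = {us ! ((Suc j + i) mod l), us ! (Suc ((Suc j + i) mod l) mod l)}"
      using i(2) edge[OF i(1)] by (rule trans)
    ultimately show "x \<in> edges C" unfolding E by blast
  qed
  have last: "e = {vs ! (l - 1), vs ! 0}"
  proof -
    have "(Suc j + (l - 1)) mod l = j" "(Suc j + 0) mod l = Suc j mod l" using j l by simp_all
    then show ?thesis using nth[of "l - 1"] nth[of 0] l j(2) by simp
  qed
  have "{{vs ! i, vs ! (Suc i mod l)} | i. i < l} = insert e {{vs ! i, vs ! Suc i} |i. i < l - 1}"
    (is "?A = ?B")
  proof (intro equalityI subsetI)
    fix x assume "x \<in> ?A"
    then obtain i where i: "i < l" "x = {vs ! i, vs ! (Suc i mod l)}" by blast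
    show "x \<in> ?B"
    proof (cases "i = l - 1")
      case True
      then have "x = e" using i last l by simp
      then show ?thesis by blast
    next
      case False
      then have "i < l - 1" "Suc i mod l = Suc i" using i by simp_all
      then show ?thesis using i by auto
    qed
  next
    fix x assume "x \<in> ?B"
    then consider "x = e" | i where "i < l - 1" "x = {vs ! i, vs ! Suc i}" by blast
    then show "x \<in> ?A"
    proof cases
      case 1
      then have "x = {vs ! (l - 1), vs ! (Suc (l - 1) mod l)}" using last l by simp
      moreover have "l - 1 < l" using l by simp
      ultimately show ?thesis by blast
    next
      case 2
      then have "Suc i mod l = Suc i" "i < l" by simp_all
      then show ?thesis using 2 by auto
    qed
  qed
  then show thesis
    using that[of vs] us last E' unfolding vs_def by simp
qed

lemma arc_Suc:
  assumes "distinct vs" "Suc a < length vs"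
  shows "{vs ! a, vs ! Suc a} \<notin> {{vs ! i, vs ! Suc i} |i. i < a}"
    and "{{vs ! i, vs ! Suc i} |i. i < Suc a} = insert {vs ! a, vs ! Suc a} {{vs ! i, vs ! Suc i} |i. i < a}"
  using assms by (auto simp: doubleton_eq_iff nth_eq_iff_index_eq less_Suc_eq)

lemma card_arc:
  assumes "distinct vs" "a < length vs"
  shows "card {{vs ! i, vs ! Suc i} |i. i < a} = a"
  using assms(2)
proof (induction a)
  case (Suc a)
  then show ?case using arc_Suc[OF assms(1) Suc.prems] by simp
qed simp

lemma insert_eq_sym_diff: "x \<notin> A \<Longrightarrow> insert x A = sym_diff A {x}"
  by auto

lemma vertex_boundary_arc:
  assumes "distinct vs" "a < length vs"
  shows "vertex_boundary {{vs ! i, vs ! Suc i} |i. i < a} = sym_diff {vs ! 0} {vs ! a}"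
  using assms(2)
proof (induction a)
  case (Suc a)
  let ?A = "{{vs ! i, vs ! Suc i} |i. i < a}"
  have ne: "vs ! a \<noteq> vs ! Suc a"
    using Suc.prems assms(1) by (simp add: nth_eq_iff_index_eq)
  have "vertex_boundary {{vs ! i, vs ! Suc i} |i. i < Suc a} =
      sym_diff (vertex_boundary ?A) (vertex_boundary {{vs ! a, vs ! Suc a}})"
    unfolding arc_Suc(2)[OF assms(1) Suc.prems]
      insert_eq_sym_diff[OF arc_Suc(1)[OF assms(1) Suc.prems]]
    by (rule mod2_sum_sym_diff) simp_all
  also have "\<dots> = sym_diff (sym_diff {vs ! 0} {vs ! a}) {vs ! a, vs ! Suc a}"
    using Suc by simp
  also have "\<dots> = sym_diff {vs ! 0} {vs ! Suc a}"
    using ne by auto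
  finally show ?case .
qed simp

lemma closing_edge_notin_arc:
  assumes "distinct vs" "length vs = l" "l \<ge> 3"
  shows "{vs ! (l - 1), vs ! 0} \<notin> {{vs ! i, vs ! Suc i} |i. i < l - 1}"
proof
  assume "{vs ! (l - 1), vs ! 0} \<in> {{vs ! i, vs ! Suc i} |i. i < l - 1}"
  then obtain i where i: "i < l - 1" "{vs ! (l - 1), vs ! 0} = {vs ! i, vs ! Suc i}" by blast
  have inj: "p = q" if "vs ! p = vs ! q" "p < l" "q < l" for p q
    using that assms by (simp add: nth_eq_iff_index_eq)
  from i(2) consider "vs ! (l - 1) = vs ! i" | "vs ! (l - 1) = vs ! Suc i" "vs ! 0 = vs ! i"
    by (auto simp: doubleton_eq_iff)
  then show False
  proof cases
    case 1
    then show False using inj[of "l - 1" i] i(1) assms(3) by linarith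
  next
    case 2
    then show False using inj[of "l - 1" "Suc i"] inj[of 0 i] i(1) assms(3) by linarith
  qed
qed

lemma cycle_length_ge: "is_cycle l C \<Longrightarrow> l \<ge> 3"
  by (simp add: is_cycle_def)

lemma cycle_edges_nonempty:
  assumes "is_cycle l C"
  obtains e where "e \<in> edges C"
proof -
  from assms obtain vs where "l \<ge> 3" "edges C = {{vs ! i, vs ! (Suc i mod l)} | i. i < l}"
    unfolding is_cycle_def by blast
  then have "{vs ! 0, vs ! (Suc 0 mod l)} \<in> edges C" by force
  then show thesis by (rule that)
qed

lemma
  assumes "is_cycle l C"
  shows card_edges_cycle: "card (edges C) = l"
    and card_verts_cycle: "card (verts C) = l"
    and finite_edges_cycle: "finite (edges C)"
    and vertex_boundary_cycle: "vertex_boundary (edges C) = {}"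
    and verts_cycle_subset: "verts C \<subseteq> \<Union>(edges C)"
    and cycle_connected: "\<exists>v0\<in>verts C. \<forall>K. v0 \<in> K \<longrightarrow>
       (\<forall>e\<in>edges C. e \<inter> K \<noteq> {} \<longrightarrow> e \<subseteq> K) \<longrightarrow> verts C \<subseteq> K"
proof -
  obtain e where eC: "e \<in> edges C" using cycle_edges_nonempty[OF assms] .
  obtain vs where vs: "distinct vs" "length vs = l" "verts C = set vs"
    and e: "e = {vs ! (l - 1), vs ! 0}"
    and E: "edges C = insert e {{vs ! i, vs ! Suc i} |i. i < l - 1}" (is "_ = insert e ?A")
    by (rule cycle_starting_after_edge[OF assms eC])
  have l: "l \<ge> 3" using assms by (rule cycle_length_ge)
  have eA: "e \<notin> ?A" unfolding e using closing_edge_notin_arc[OF vs(1,2) l] .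
  have lt: "l - 1 < length vs" using l vs by simp
  show "card (edges C) = l"
    unfolding E using eA card_arc[OF vs(1) lt] l by simp
  show "card (verts C) = l"
    using vs by (simp add: distinct_card)
  show "finite (edges C)" unfolding E by simp
  have "vertex_boundary (edges C) = sym_diff (vertex_boundary ?A) (vertex_boundary {e})"
    unfolding E insert_eq_sym_diff[OF eA] by (rule mod2_sum_sym_diff) simp_all
  also have "\<dots> = sym_diff (sym_diff {vs ! 0} {vs ! (l - 1)}) e"
    using vertex_boundary_arc[OF vs(1) lt] by simp
  also have "\<dots> = {}"
    unfolding e using vs l nth_eq_iff_index_eq[of vs 0 "l - 1"] by auto
  finally show "vertex_boundary (edges C) = {}" .
  show "verts C \<subseteq> \<Union>(edges C)"
  proof
    fix v assume "v \<in> verts C"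
    then obtain i where i: "i < l" "v = vs ! i" using vs by (metis in_set_conv_nth)
    show "v \<in> \<Union>(edges C)"
    proof (cases "i < l - 1")
      case True
      then have "{vs ! i, vs ! Suc i} \<in> edges C" unfolding E by blast
      then show ?thesis using i by blast
    next
      case False
      then have "i = l - 1" using i by simp
      then show ?thesis unfolding E e using i by blast
    qed
  qed
  show "\<exists>v0\<in>verts C. \<forall>K. v0 \<in> K \<longrightarrow> (\<forall>e\<in>edges C. e \<inter> K \<noteq> {} \<longrightarrow> e \<subseteq> K) \<longrightarrow> verts C \<subseteq> K"
  proof (intro bexI[of _ "vs ! 0"] allI impI)
    fix K assume K: "vs ! 0 \<in> K" "\<forall>e\<in>edges C. e \<inter> K \<noteq> {} \<longrightarrow> e \<subseteq> K"
    have "i < l \<Longrightarrow> vs ! i \<in> K" for i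
    proof (induction i)
      case (Suc i)
      have "i < l - 1" using Suc.prems by simp
      then have "{vs ! i, vs ! Suc i} \<in> edges C" unfolding E by blast
      moreover have "vs ! i \<in> K" using Suc by simp
      then have "{vs ! i, vs ! Suc i} \<inter> K \<noteq> {}" by simp
      ultimately have "{vs ! i, vs ! Suc i} \<subseteq> K" by (rule K(2)[rule_format])
      then show ?case by simp
    qed (use K(1) in simp)
    then show "verts C \<subseteq> K" unfolding vs(3) using vs(2) by (auto simp: in_set_conv_nth)
  next
    show "vs ! 0 \<in> verts C" using vs l by simp
  qed
qed

text \<open>Even sets have no vertices of degree 1, which is what allows a walk to be continued.\<close>

lemma edge_incident_even:
  assumes "finite E" "vertex_boundary E = {}" "e \<in> E" "v \<in> e"
  obtains e' where "e' \<in> E" "v \<in> e'" "e' \<noteq> e"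
proof -
  let ?I = "{e \<in> E. v \<in> e}"
  have "even (card ?I)" using assms(2) by (auto simp: mod2_sum_def)
  moreover have "?I \<noteq> {e}" if "even (card ?I)"
    using that by (metis One_nat_def card.empty card_insert_if empty_iff finite.emptyI odd_one)
  ultimately have "?I \<noteq> {e}" by blast
  moreover have "e \<in> ?I" using assms by simp
  ultimately show thesis using that by blast
qed

definition edge_path :: "'a set set \<Rightarrow> 'a list \<Rightarrow> bool" where
  "edge_path E vs \<longleftrightarrow> distinct vs \<and> (\<forall>i. Suc i < length vs \<longrightarrow> {vs ! i, vs ! Suc i} \<in> E)"

text \<open>The first vertex of a longest path has a second edge, and by maximality this edge leads back to the
  path and closes a cycle.\<close>

lemma even_edge_set_contains_cycle:
  assumes fin: "finite E" and two: "\<And>e. e \<in> E \<Longrightarrow> card e = 2"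
    and ev: "vertex_boundary E = {}" and ne: "E \<noteq> {}"
  obtains l C where "is_cycle l C" "edges C \<subseteq> E"
proof -
  obtain a b where ab: "{a, b} \<in> E" "a \<noteq> b"
    using ne two by (metis card_2_iff ex_in_conv)
  have finV: "finite (\<Union>E)"
    using fin two by (metis card.infinite finite_Union zero_neq_numeral)
  have inV: "set vs \<subseteq> \<Union>E" if "edge_path E vs" "length vs \<ge> 2" for vs
  proof
    fix v assume "v \<in> set vs"
    then obtain i where i: "i < length vs" "v = vs ! i" by (metis in_set_conv_nth)
    show "v \<in> \<Union>E"
    proof (cases "Suc i < length vs")
      case True
      then show ?thesis using that(1) i unfolding edge_path_def by blast
    next
      case False
      then have "Suc (i - 1) = i" using i that(2) by simp
      then have "{vs ! (i - 1), vs ! i} \<in> E"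
        using that(1) i unfolding edge_path_def by metis
      then show ?thesis using i by blast
    qed
  qed
  define P where "P vs \<longleftrightarrow> edge_path E vs \<and> length vs \<ge> 2" for vs
  have "P [a, b]" using ab by (auto simp: P_def edge_path_def less_Suc_eq)
  moreover have "\<forall>vs. P vs \<longrightarrow> length vs \<le> card (\<Union>E)"
  proof (intro allI impI)
    fix vs assume "P vs"
    then have "distinct vs" "set vs \<subseteq> \<Union>E" using inV by (auto simp: P_def edge_path_def)
    then show "length vs \<le> card (\<Union>E)"
      by (metis card_mono distinct_card finV)
  qed
  ultimately have "\<exists>vs. P vs \<and> (\<forall>us. P us \<longrightarrow> length us \<le> length vs)"
    by (intro ex_has_greatest_nat[of P "[a, b]" length "Suc (card (\<Union>E))"]) (auto simp: less_Suc_eq_le)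
  then obtain vs where vs: "P vs" and max: "\<And>us. P us \<Longrightarrow> length us \<le> length vs"
    by blast
  have len: "length vs \<ge> 2" and dist: "distinct vs"
    and edg: "\<And>i. Suc i < length vs \<Longrightarrow> {vs ! i, vs ! Suc i} \<in> E"
    using vs by (auto simp: P_def edge_path_def)
  have first: "{vs ! 0, vs ! 1} \<in> E" using edg[of 0] len by simp
  obtain e' where e': "e' \<in> E" "vs ! 0 \<in> e'" "e' \<noteq> {vs ! 0, vs ! 1}"
    using edge_incident_even[OF fin ev first] by blast
  then obtain w where w: "e' = {vs ! 0, w}" "w \<noteq> vs ! 0"
    using two[OF e'(1)] by (metis card_2_iff doubleton_eq_iff insert_iff singletonD)
  have "w \<in> set vs"
  proof (rule ccontr)
    assume "w \<notin> set vs"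
    moreover have "{(w # vs) ! i, (w # vs) ! Suc i} \<in> E" if "Suc i < length (w # vs)" for i
      using that edg e' w by (cases i) (auto simp: insert_commute)
    ultimately have "P (w # vs)" using dist len by (simp add: P_def edge_path_def)
    then show False using max by fastforce
  qed
  then obtain j where j: "j < length vs" "w = vs ! j" by (metis in_set_conv_nth)
  have "j \<noteq> 0" "j \<noteq> 1" using w e' j by (metis)+
  then have j2: "j \<ge> 2" by simp
  define us where "us = take (Suc j) vs"
  have lenu: "length us = Suc j" using j by (simp add: us_def)
  have nthu: "us ! i = vs ! i" if "i \<le> j" for i using that by (simp add: us_def)
  define C where "C = Graph (set us) {{us ! i, us ! (Suc i mod Suc j)} | i. i < Suc j}"
  have "distinct us" using dist by (simp add: us_def)
  then have "is_cycle (Suc j) C"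
    unfolding is_cycle_def C_def using j2 lenu by (intro conjI exI[of _ us]) simp_all
  moreover have "edges C \<subseteq> E"
  proof
    fix x assume "x \<in> edges C"
    then obtain i where i: "i < Suc j" "x = {us ! i, us ! (Suc i mod Suc j)}" by (auto simp: C_def)
    show "x \<in> E"
    proof (cases "i = j")
      case True
      then have "x = e'" using i w j nthu by auto
      then show ?thesis using e' by simp
    next
      case False
      then have "x = {vs ! i, vs ! Suc i}" using i nthu by simp
      then show ?thesis using edg[of i] False i j by simp
    qed
  qed
  ultimately show thesis using that by blast
qed

text \<open>Removing the edges of a cycle from an even set leaves an even set, so even sets are disjoint unions
  of cycles.\<close>

lemma cycle_decomposition_induct [consumes 3, case_names empty cycle]:
  assumes "finite E" "\<forall>e\<in>E. card e = 2" "vertex_boundary E = {}"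
    and "P {}"
    and "\<And>l C E. is_cycle l C \<Longrightarrow> finite E \<Longrightarrow> edges C \<subseteq> E \<Longrightarrow> P (E - edges C) \<Longrightarrow> P E"
  shows "P E"
  using assms(1-3)
proof (induction "card E" arbitrary: E rule: less_induct)
  case less
  show ?case
  proof (cases "E = {}")
    case False
    obtain l C where C: "is_cycle l C" "edges C \<subseteq> E"
      using even_edge_set_contains_cycle[OF less.prems(1) less.prems(2)[rule_format] less.prems(3) False]
      by blast
    have eq: "E - edges C = sym_diff E (edges C)"
      using C(2) by (simp only: Diff_eq_empty_iff[THEN iffD2] Un_empty_right)
    have "vertex_boundary (E - edges C) = {}"
      by (subst eq, subst mod2_sum_sym_diff[OF less.prems(1) finite_edges_cycle[OF C(1)]])
        (simp add: less.prems(3) vertex_boundary_cycle[OF C(1)])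
    moreover have "E - edges C \<subset> E"
      using C(2) cycle_edges_nonempty[OF C(1)] by (metis Diff_iff Diff_subset psubsetI subsetD)
    then have "card (E - edges C) < card E"
      by (rule psubset_card_mono[OF less.prems(1)])
    ultimately have "P (E - edges C)"
      using less.prems(1,2) by (intro less.hyps) auto
    then show ?thesis by (rule assms(5)[OF C(1) less.prems(1) C(2)])
  next
    case True
    then show ?thesis using assms(4) by (simp only:)
  qed
qed

text \<open>A walk contributes the edges that it traverses an odd number of times. This avoids extracting a
  path from it, and only the boundary and the number of edges matter for cutting cycles.\<close>

lemma vertex_boundary_walk:
  assumes "(u, v) \<in> adj_rel T ^^ k" "simple_graph T"
  shows "\<exists>P. P \<subseteq> edges T \<and> finite P \<and> card P \<le> k \<and> vertex_boundary P = sym_diff {u} {v}"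
  using assms(1)
proof (induction k arbitrary: v)
  case 0
  then show ?case by (intro exI[of _ "{}"]) simp
next
  case (Suc k)
  obtain w where w: "(u, w) \<in> adj_rel T ^^ k" "(w, v) \<in> adj_rel T"
    using Suc.prems by (rule relpow_Suc_E)
  then have wvT: "{w, v} \<in> edges T" by (simp add: adj_rel_def)
  obtain P where P: "P \<subseteq> edges T" "finite P" "card P \<le> k"
    "vertex_boundary P = sym_diff {u} {w}" using Suc.IH[OF w(1)] by (elim exE conjE)
  have "card {w, v} = 2" using wvT assms(2) unfolding simple_graph_def by blast
  then have wv: "w \<noteq> v" by auto
  let ?Q = "sym_diff P {{w, v}}"
  have "vertex_boundary ?Q = sym_diff (sym_diff {u} {w}) {w, v}"
    by (simp only: mod2_sum_sym_diff[OF P(2) finite.insertI[OF finite.emptyI]] P(4) mod2_sum_singleton)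
  also have "\<dots> = sym_diff {u} {v}" using wv by auto
  finally have "vertex_boundary ?Q = sym_diff {u} {v}" .
  moreover have "card ?Q \<le> Suc k"
    using card_sym_diff_le[OF P(2), of "{{w, v}}"] P(3) by simp
  moreover have "?Q \<subseteq> edges T" using P(1) wvT by blast
  moreover have "finite ?Q" using P(2) by simp
  ultimately show ?case by (intro exI[of _ ?Q] conjI)
qed

lemma relpow_le_diameter:
  assumes "is_tree T" "u \<in> verts T" "v \<in> verts T"
  obtains k where "k \<le> graph_diameter T" "(u, v) \<in> adj_rel T ^^ k"
proof -
  have "(u, v) \<in> (adj_rel T)\<^sup>*" and fin: "finite (verts T)"
    using assms by (auto simp: is_tree_def connected_graph_def simple_graph_def)
  then obtain k where "(u, v) \<in> adj_rel T ^^ k" by (metis rtrancl_imp_relpow)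
  then have 1: "(u, v) \<in> adj_rel T ^^ graph_dist T u v"
    unfolding graph_dist_def by (rule LeastI)
  have "{graph_dist T u v | u v. u \<in> verts T \<and> v \<in> verts T} =
      (\<lambda>(u, v). graph_dist T u v) ` (verts T \<times> verts T)" by auto
  then have "finite {graph_dist T u v | u v. u \<in> verts T \<and> v \<in> verts T}"
    using fin by simp
  then have "graph_dist T u v \<le> graph_diameter T"
    unfolding graph_diameter_def using assms by (intro Max_ge) auto
  then show thesis using that[OF _ 1] by simp
qed

section \<open>Fillings by triangles\<close>

lemma edges_stage: "k \<le> length Ds \<Longrightarrow> edges (stage H Ds k) = edges H \<union> (\<Union>i<k. edges (Ds ! i))"
proof (induction k)
  case (Suc k)
  then have "stage H Ds (Suc k) = graph_union (stage H Ds k) (Ds ! k)"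
    by (simp add: stage_def take_Suc_conv_app_nth)
  then show ?case using Suc by (auto simp: graph_union_def less_Suc_eq)
qed (simp add: stage_def)

lemma verts_stage: "k \<le> length Ds \<Longrightarrow> verts (stage H Ds k) = verts H \<union> (\<Union>i<k. verts (Ds ! i))"
proof (induction k)
  case (Suc k)
  then have "stage H Ds (Suc k) = graph_union (stage H Ds k) (Ds ! k)"
    by (simp add: stage_def take_Suc_conv_app_nth)
  then show ?case using Suc by (auto simp: graph_union_def less_Suc_eq)
qed (simp add: stage_def)

lemma triangle_with_edge:
  assumes "is_cycle 3 D" "e \<in> edges D"
  obtains x y z where "e = {z, x}" "edges D = {{z, x}, {x, y}, {y, z}}" "verts D = {x, y, z}"
proof -
  obtain vs where "distinct vs" and vs: "length vs = 3" "verts D = set vs" "e = {vs ! (3 - 1), vs ! 0}"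
    "edges D = insert e {{vs ! i, vs ! Suc i} |i. i < 3 - 1}"
    by (rule cycle_starting_after_edge[OF assms])
  obtain x y z where xyz: "vs = [x, y, z]"
    using vs(1) by (auto simp: numeral_3_eq_3 length_Suc_conv)
  have "{{vs ! i, vs ! Suc i} |i. i < 3 - 1} = (\<lambda>i. {vs ! i, vs ! Suc i}) ` {..<2}" by auto
  also have "{..<2} = {0, 1::nat}" by auto
  finally have "{{vs ! i, vs ! Suc i} |i. i < 3 - 1} = {{x, y}, {y, z}}" by (simp add: xyz)
  then show thesis using that[of z x y] vs by (simp add: xyz)
qed

text \<open>Of an activation process only the order of the triangles is kept: \<open>new i\<close> is the edge activated by
  the \<open>i\<close>-th triangle, and no earlier triangle contains it. This property passes to every
  subsequence, whatever the initial graph is.\<close>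

locale triangle_sequence =
  fixes G :: "'a ugraph" and Ds :: "'a ugraph list" and new :: "nat \<Rightarrow> 'a set"
  assumes triangle: "i < length Ds \<Longrightarrow> is_cycle 3 (Ds ! i)"
    and triangle_subgraph: "i < length Ds \<Longrightarrow> subgraph (Ds ! i) G"
    and new_in: "i < length Ds \<Longrightarrow> new i \<in> edges (Ds ! i)"
    and new_first: "i < length Ds \<Longrightarrow> j < length Ds \<Longrightarrow> new i \<in> edges (Ds ! j) \<Longrightarrow> i \<le> j"
begin

abbreviation triangle_boundary :: "nat set \<Rightarrow> 'a set set" where
  "triangle_boundary S \<equiv> mod2_sum (\<lambda>i. edges (Ds ! i)) S"

definition span_verts :: "nat set \<Rightarrow> 'a set" where
  "span_verts S = (\<Union>i\<in>S. verts (Ds ! i))"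

definition span_edges :: "nat set \<Rightarrow> 'a set set" where
  "span_edges S = (\<Union>i\<in>S. edges (Ds ! i))"

text \<open>The initial graph of the process formed by the triangles in \<open>S\<close>. Activated edges join vertices of
  their triangle, so no vertex is lost by removing them.\<close>

definition seed :: "nat set \<Rightarrow> 'a ugraph" where
  "seed S = Graph (span_verts S) (span_edges S - new ` S)"

definition subprocess :: "nat set \<Rightarrow> 'a ugraph list" where
  "subprocess S = map ((!) Ds) (sorted_list_of_set S)"

lemma new_inj: "i < length Ds \<Longrightarrow> j < length Ds \<Longrightarrow> new i = new j \<Longrightarrow> i = j"
  using new_first new_in by (metis order_antisym)

lemma triangle_simple:
  assumes "i < length Ds" "e \<in> edges (Ds ! i)"
  shows "e \<subseteq> verts (Ds ! i)" "card e = 2" "e \<in> edges G"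
  using triangle_subgraph[OF assms(1)] assms(2) by (auto simp: subgraph_def simple_graph_def)

lemma finite_triangle_verts: "i < length Ds \<Longrightarrow> finite (verts (Ds ! i))"
  using triangle_subgraph by (auto simp: subgraph_def simple_graph_def)

lemma finite_index: "S \<subseteq> {..<length Ds} \<Longrightarrow> finite S"
  using finite_subset by blast

lemma finite_span_verts: "S \<subseteq> {..<length Ds} \<Longrightarrow> finite (span_verts S)"
  using finite_index finite_triangle_verts unfolding span_verts_def by blast

text \<open>The edge activated by the last triangle of \<open>S\<close> lies in no other triangle of \<open>S\<close>, so it survives in
  the boundary. Hence fillings are unique, and this is the form in which the absence of closed
  surfaces enters.\<close>

lemma triangle_boundary_eq_empty:
  assumes S: "S \<subseteq> {..<length Ds}" and "triangle_boundary S = {}"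
  shows "S = {}"
proof (rule ccontr)
  assume "S \<noteq> {}"
  \<comment> \<open>the last triangle of \<open>S\<close>\<close>
  define m where "m = Max S"
  have m: "m \<in> S" "\<And>i. i \<in> S \<Longrightarrow> i \<le> m"
    using \<open>S \<noteq> {}\<close> finite_index[OF S] by (simp_all add: m_def)
  have lt: "i < length Ds" if "i \<in> S" for i
    using S that by blast
  have "i = m" if "i \<in> S" "new m \<in> edges (Ds ! i)" for i
    using new_first[OF lt[OF m(1)] lt[OF that(1)] that(2)] m(2)[OF that(1)] by simp
  then have "{i \<in> S. new m \<in> edges (Ds ! i)} = {m}"
    using m(1) new_in[OF lt[OF m(1)]] by blast
  then have "new m \<in> triangle_boundary S"
    by (simp add: mod2_sum_def)
  then show False using assms(2) by simp
qed

context
  fixes S :: "nat set"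
  assumes S: "S \<subseteq> {..<length Ds}"
begin

lemma S_lt: "i \<in> S \<Longrightarrow> i < length Ds"
  using S by blast

lemma subgraph_seed: "simple_graph G \<Longrightarrow> subgraph (seed S) G"
  unfolding subgraph_def simple_graph_def seed_def
  using finite_span_verts[OF S] triangle_simple[OF S_lt] triangle_subgraph[OF S_lt]
  by (fastforce simp: span_verts_def span_edges_def subgraph_def)

text \<open>Each activated edge can be replaced by the two other edges of its triangle, which are in the seed
  or have been activated earlier.\<close>

lemma seed_connects_triangle:
  assumes "i \<in> S" "u \<in> verts (Ds ! i)" "v \<in> verts (Ds ! i)"
  shows "(u, v) \<in> (adj_rel (seed S))\<^sup>*"
  using assms
proof (induction i arbitrary: u v rule: less_induct)
  case (less i)
  let ?R = "(adj_rel (seed S))\<^sup>*"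
  have old: "(x, y) \<in> ?R" if f: "{x, y} \<in> edges (Ds ! i)" "{x, y} \<noteq> new i" for x y
  proof (cases "{x, y} \<in> new ` S")
    case True
    then obtain j where j: "j \<in> S" "{x, y} = new j" by blast
    have "j \<le> i" using new_first[OF S_lt[OF j(1)] S_lt[OF less.prems(1)]] f j by simp
    then have "j < i" using f(2) j(2) by (cases "j = i") auto
    moreover have "{x, y} \<subseteq> verts (Ds ! j)"
      using triangle_simple(1)[OF S_lt[OF j(1)] new_in[OF S_lt[OF j(1)]]] j(2) by simp
    ultimately show ?thesis using less.IH j(1) by simp
  next
    case False
    then have "{x, y} \<in> edges (seed S)"
      using f less.prems(1) by (auto simp: seed_def span_edges_def)
    then show ?thesis by (simp add: adj_rel_def r_into_rtrancl)
  qed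
  obtain x y z where e: "new i = {z, x}" and E: "edges (Ds ! i) = {{z, x}, {x, y}, {y, z}}"
    and V: "verts (Ds ! i) = {x, y, z}"
    by (rule triangle_with_edge[OF triangle[OF S_lt[OF less.prems(1)]] new_in[OF S_lt[OF less.prems(1)]]])
  have "card (verts (Ds ! i)) = 3"
    using card_verts_cycle[OF triangle] S_lt[OF less.prems(1)] by blast
  then have dist: "x \<noteq> y" "y \<noteq> z" "x \<noteq> z"
    unfolding V by (auto simp: card_insert_if split: if_splits)
  have "{x, y} \<noteq> new i" "{y, z} \<noteq> new i"
    unfolding e using dist by (simp_all add: doubleton_eq_iff)
  then have R: "(x, y) \<in> ?R" "(y, x) \<in> ?R" "(y, z) \<in> ?R" "(z, y) \<in> ?R"
    using old[of x y] old[of y x] old[of y z] old[of z y]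
    by (simp_all add: E insert_commute[of y "x"] insert_commute[of z "y"])
  then have "(x, z) \<in> ?R" "(z, x) \<in> ?R"
    using rtrancl_trans[OF R(1,3)] rtrancl_trans[OF R(4,2)] by simp_all
  then show ?case
    using less.prems(2,3) R unfolding V by (elim insertE emptyE) simp_all
qed

text \<open>The triangles outside the component that contains the cycle have empty boundary among themselves,
  so by \<open>triangle_boundary_eq_empty\<close> there are none.\<close>

lemma seed_connected:
  assumes C: "is_cycle l C" "triangle_boundary S = edges C"
  shows "connected_graph (seed S)"
proof -
  let ?R = "(adj_rel (seed S))\<^sup>*"
  obtain v0 where v0: "v0 \<in> verts C" and
    conn: "\<forall>K. v0 \<in> K \<longrightarrow> (\<forall>e\<in>edges C. e \<inter> K \<noteq> {} \<longrightarrow> e \<subseteq> K) \<longrightarrow> verts C \<subseteq> K"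
    using cycle_connected[OF C(1)] by (elim bexE)
  define K where "K = {x. (v0, x) \<in> ?R}"
  have tri: "verts (Ds ! i) \<subseteq> K" if "i \<in> S" "x \<in> verts (Ds ! i)" "x \<in> K" for i x
    using seed_connects_triangle[OF that(1,2)] that(3) unfolding K_def
    by (auto intro: rtrancl_trans)
  have sub: "edges C \<subseteq> span_edges S"
    using mod2_sum_subset[of "\<lambda>i. edges (Ds ! i)" S] C(2) by (simp add: span_edges_def)
  have edge_tri: "e \<subseteq> verts (Ds ! i)" "e \<noteq> {}" if "i \<in> S" "e \<in> edges (Ds ! i)" for i e
    using triangle_simple[OF S_lt[OF that(1)] that(2)] by auto
  have CK: "verts C \<subseteq> K"
  proof (rule conn[rule_format])
    show "v0 \<in> K" by (simp add: K_def)
    fix e assume e: "e \<in> edges C" "e \<inter> K \<noteq> {}"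
    then obtain i where "i \<in> S" "e \<in> edges (Ds ! i)" using sub by (auto simp: span_edges_def)
    then show "e \<subseteq> K" using tri edge_tri e(2) by blast
  qed
  have edge_C: "e \<inter> K \<noteq> {}" if e: "e \<in> edges C" for e
  proof -
    obtain vs where "distinct vs" and vs: "length vs = l" "verts C = set vs" "e = {vs ! (l - 1), vs ! 0}"
      and "edges C = insert e {{vs ! i, vs ! Suc i} |i. i < l - 1}"
      by (rule cycle_starting_after_edge[OF C(1) e])
    then have "vs ! 0 \<in> verts C" using cycle_length_ge[OF C(1)] by simp
    then have "vs ! 0 \<in> K" using CK by (rule rev_subsetD)
    then show ?thesis unfolding vs(3) by simp
  qed
  \<comment> \<open>the triangles outside the component \<open>K\<close> of the cycle\<close>
  define S' where "S' = {i \<in> S. \<not> verts (Ds ! i) \<subseteq> K}"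
  have "even (card {i \<in> S'. e \<in> edges (Ds ! i)})" for e
  proof (cases "e \<inter> K = {}")
    case True
    have "\<not> verts (Ds ! i) \<subseteq> K" if "i \<in> S" "e \<in> edges (Ds ! i)" for i
      using edge_tri[OF that] True by blast
    then have "{i \<in> S'. e \<in> edges (Ds ! i)} = {i \<in> S. e \<in> edges (Ds ! i)}"
      by (auto simp: S'_def)
    moreover have "e \<notin> triangle_boundary S" unfolding C(2) using True edge_C[of e] by metis
    ultimately show ?thesis by (simp add: mod2_sum_def)
  next
    case False
    then obtain x where x: "x \<in> e" "x \<in> K" by blast
    have "verts (Ds ! i) \<subseteq> K" if "i \<in> S" "e \<in> edges (Ds ! i)" for i
      using that(1) subsetD[OF edge_tri(1)[OF that] x(1)] x(2) by (rule tri)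
    then have "{i \<in> S'. e \<in> edges (Ds ! i)} = {}"
      by (auto simp: S'_def)
    then show ?thesis by (simp only: card.empty even_zero)
  qed
  then have "triangle_boundary S' = {}" by (simp add: mod2_sum_def)
  moreover have "S' \<subseteq> {..<length Ds}" using S by (auto simp: S'_def)
  ultimately have "S' = {}" by (rule triangle_boundary_eq_empty[rotated])
  then have VK: "span_verts S \<subseteq> K" by (auto simp: S'_def span_verts_def)
  have "sym ?R"
    by (intro sym_rtrancl) (auto simp: sym_def adj_rel_def insert_commute)
  then have "(u, v) \<in> ?R" if "u \<in> K" "v \<in> K" for u v
    using that rtrancl_trans[OF symD[OF \<open>sym ?R\<close>, of v0 u]] unfolding K_def by simp
  moreover have "span_verts S \<noteq> {}"
  proof -
    obtain e where "e \<in> edges C" using cycle_edges_nonempty[OF C(1)] .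
    then obtain i where i: "i \<in> S" "e \<in> edges (Ds ! i)" using sub by (auto simp: span_edges_def)
    then show ?thesis using edge_tri[OF i] by (auto simp: span_verts_def)
  qed
  ultimately show ?thesis
    using VK unfolding connected_graph_def seed_def by auto
qed

abbreviation index :: "nat \<Rightarrow> nat" where
  "index k \<equiv> sorted_list_of_set S ! k"

lemma length_subprocess: "length (subprocess S) = length (sorted_list_of_set S)"
  by (simp add: subprocess_def)

lemma nth_subprocess: "k < length (subprocess S) \<Longrightarrow> subprocess S ! k = Ds ! index k"
  by (simp add: subprocess_def)

lemma index_in: "k < length (subprocess S) \<Longrightarrow> index k \<in> S"
  using finite_index[OF S] nth_mem length_subprocess by (metis set_sorted_list_of_set)

lemma index_surj:
  assumes "i \<in> S"
  obtains k where "k < length (subprocess S)" "index k = i"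
  using assms finite_index[OF S] length_subprocess by (metis in_set_conv_nth set_sorted_list_of_set)

lemma index_less: "j < k \<Longrightarrow> k < length (subprocess S) \<Longrightarrow> index j < index k"
  using strict_sorted_list_of_set[of S] sorted_wrt_nth_less length_subprocess by metis

lemma index_less_iff:
  "j < length (subprocess S) \<Longrightarrow> k < length (subprocess S) \<Longrightarrow> index j < index k \<longleftrightarrow> j < k"
  using index_less by (metis less_asym linorder_neqE_nat)

lemma edges_stage_subprocess:
  assumes "k \<le> length (subprocess S)"
  shows "edges (stage (seed S) (subprocess S) k) =
    edges (seed S) \<union> (\<Union>j<k. edges (Ds ! index j))"
  using assms edges_stage[OF assms] nth_subprocess by auto

lemma verts_stage_subprocess:
  assumes "k \<le> length (subprocess S)"
  shows "verts (stage (seed S) (subprocess S) k) = span_verts S"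
proof -
  have "verts (subprocess S ! j) \<subseteq> span_verts S" if "j < k" for j
    using that assms nth_subprocess[of j] index_in[of j] by (auto simp: span_verts_def)
  then show ?thesis
    using verts_stage[OF assms] by (auto simp: seed_def)
qed

lemma new_notin_stage:
  assumes "k < length (subprocess S)"
  shows "new (index k) \<notin> edges (stage (seed S) (subprocess S) k)"
proof
  assume "new (index k) \<in> edges (stage (seed S) (subprocess S) k)"
  then consider "new (index k) \<in> edges (seed S)" | j where "j < k" "new (index k) \<in> edges (Ds ! index j)"
    using edges_stage_subprocess[of k] assms by auto
  then show False
  proof cases
    case 1
    then show False using index_in[OF assms] by (auto simp: seed_def)
  next
    case 2
    then have "index k \<le> index j"
      using new_first S_lt index_in assms by (meson order_less_trans)
    then show False using index_less[OF 2(1) assms] by simp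
  qed
qed

text \<open>The other two edges of the triangle are present: one that is not in the seed is activated by a
  triangle of \<open>S\<close>, and this triangle comes earlier because of \<open>new_first\<close>.\<close>

lemma stage_subprocess_Suc:
  assumes k: "k < length (subprocess S)"
  shows "edges (stage (seed S) (subprocess S) (Suc k)) =
    insert (new (index k)) (edges (stage (seed S) (subprocess S) k))"
proof -
  have iS: "index k \<in> S" using index_in[OF k] .
  have "f \<in> edges (stage (seed S) (subprocess S) k)"
    if f: "f \<in> edges (Ds ! index k)" "f \<noteq> new (index k)" for f
  proof (cases "f \<in> new ` S")
    case True
    then obtain i where i: "i \<in> S" "f = new i" by blast
    obtain j where j: "j < length (subprocess S)" "index j = i" using index_surj[OF i(1)] .
    have "i \<le> index k" using new_first[OF S_lt[OF i(1)] S_lt[OF iS]] f i by simp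
    moreover have "i \<noteq> index k" using f(2) i(2) by blast
    ultimately have "j < k" using index_less_iff[OF j(1) k] j(2) by simp
    moreover have "f \<in> edges (Ds ! index j)" using new_in[OF S_lt[OF i(1)]] i j by simp
    ultimately show ?thesis using edges_stage_subprocess[of k] k by auto
  next
    case False
    then have "f \<in> edges (seed S)" using f iS by (auto simp: seed_def span_edges_def)
    then show ?thesis using edges_stage_subprocess[of k] k by auto
  qed
  moreover have "edges (stage (seed S) (subprocess S) (Suc k)) =
    edges (stage (seed S) (subprocess S) k) \<union> edges (Ds ! index k)"
    using edges_stage_subprocess[of k] edges_stage_subprocess[of "Suc k"] k by (auto simp: less_Suc_eq)
  ultimately show ?thesis using new_in[OF S_lt[OF iS]] by auto
qed

lemma edges_final_subprocess: "edges (final_graph (seed S) (subprocess S)) = span_edges S"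
proof -
  have "(\<Union>j<length (subprocess S). edges (Ds ! index j)) = span_edges S"
    unfolding span_edges_def by (auto intro: index_in elim!: index_surj)
  then show ?thesis
    using edges_stage_subprocess[of "length (subprocess S)"]
    by (auto simp: final_graph_def seed_def)
qed

lemma activation_process_subprocess:
  assumes "simple_graph G"
  shows "activation_process G (seed S) (subprocess S)"
  unfolding activation_process_def
proof (intro conjI ballI allI impI)
  show "subgraph (seed S) G" using assms by (rule subgraph_seed)
next
  fix D assume "D \<in> set (subprocess S)"
  then have "D \<in> (!) Ds ` S" using finite_index[OF S] by (simp add: subprocess_def)
  then show "is_cycle 3 D" "subgraph D G"
    using triangle triangle_subgraph S_lt by auto
next
  fix k assume "k < length (subprocess S)"
  then show "verts (stage (seed S) (subprocess S) (Suc k)) = verts (stage (seed S) (subprocess S) k)"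
    using verts_stage_subprocess[of k] verts_stage_subprocess[of "Suc k"] by simp
next
  fix k assume "k < length (subprocess S)"
  then show "\<exists>e. e \<notin> edges (stage (seed S) (subprocess S) k) \<and>
      edges (stage (seed S) (subprocess S) (Suc k)) = insert e (edges (stage (seed S) (subprocess S) k))"
    using new_notin_stage stage_subprocess_Suc by blast
qed

abbreviation degree :: "'a set \<Rightarrow> nat" where
  "degree e \<equiv> card {i \<in> S. e \<in> edges (Ds ! i)}"

lemma degree_eq: "degree e = card {k. k < length (subprocess S) \<and> e \<in> edges (subprocess S ! k)}"
proof -
  let ?A = "{k. k < length (subprocess S) \<and> e \<in> edges (subprocess S ! k)}"
  have "inj_on (\<lambda>k. index k) ?A"
    by (rule inj_onI) (metis (no_types, lifting) index_less less_irrefl linorder_neqE_nat mem_Collect_eq)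
  moreover have "(\<lambda>k. index k) ` ?A = {i \<in> S. e \<in> edges (Ds ! i)}"
    by (auto simp: nth_subprocess intro: index_in elim!: index_surj)
  ultimately show ?thesis by (metis (no_types, lifting) card_image)
qed

lemma con_seed:
  assumes "e \<in> edges (seed S)"
  shows "con (seed S) (subprocess S) e = degree e"
proof -
  have "\<not> activates_edge (seed S) (subprocess S) k e" if "k < length (subprocess S)" for k
    using that assms edges_stage_subprocess[of k] by (auto simp: activates_edge_def)
  then show ?thesis unfolding con_def degree_eq by metis
qed

lemma degree_le_Suc_con: "degree e \<le> Suc (con (seed S) (subprocess S) e)"
proof -
  let ?A = "{k. k < length (subprocess S) \<and> e \<in> edges (subprocess S ! k) \<and>
      \<not> activates_edge (seed S) (subprocess S) k e}"
  let ?B = "{k. k < length (subprocess S) \<and> activates_edge (seed S) (subprocess S) k e}"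
  have new: "new (index k) = e" if "k \<in> ?B" for k
    using that stage_subprocess_Suc[of k] by (auto simp: activates_edge_def)
  have "j = k" if jk: "j \<in> ?B" "k \<in> ?B" for j k
  proof -
    have "index j = index k"
      using new_inj[of "index j" "index k"] new[OF jk(1)] new[OF jk(2)] jk S_lt index_in by simp
    then show ?thesis using index_less jk by (metis (no_types, lifting) less_irrefl linorder_neqE_nat mem_Collect_eq)
  qed
  moreover have "finite ?B" by simp
  ultimately have "card ?B \<le> Suc 0"
    by (subst card_le_Suc0_iff_eq) (assumption | intro ballI)+
  have "degree e \<le> card (?A \<union> ?B)"
    unfolding degree_eq by (intro card_mono) auto
  also have "\<dots> \<le> card ?A + card ?B" by (rule card_Un_le)
  finally show ?thesis using \<open>card ?B \<le> Suc 0\<close> by (simp add: con_def)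
qed

text \<open>The excess depends only on the number of triangles of \<open>S\<close> that contain the edge. This number is
  odd on \<open>C\<close> and a positive even number elsewhere, hence at least 1 and at least 2, respectively.\<close>

lemma nice_subprocess:
  assumes "triangle_boundary S = edges C"
  shows "nice (seed S) C (subprocess S)"
  unfolding nice_def
proof
  fix e assume "e \<in> edges (final_graph (seed S) (subprocess S))"
  then have e: "e \<in> span_edges S" by (simp add: edges_final_subprocess)
  then have "{i \<in> S. e \<in> edges (Ds ! i)} \<noteq> {}" by (auto simp: span_edges_def)
  then have pos: "degree e > 0" using finite_index[OF S] by (simp add: card_gt_0_iff)
  have "e \<in> edges C \<longleftrightarrow> odd (degree e)"
    unfolding assms[symmetric] by (simp add: mod2_sum_def)
  then have two: "e \<notin> edges C \<Longrightarrow> degree e \<ge> 2"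
    using pos by (metis One_nat_def Suc_1 Suc_leI le_neq_implies_less odd_one)
  show "0 \<le> exc (seed S) C (subprocess S) e"
    using con_seed[of e] degree_le_Suc_con[of e] pos two unfolding exc_def by auto
qed

lemma seed_activates_nicely:
  assumes G: "simple_graph G" and C: "is_cycle l C" "subgraph C G" "triangle_boundary S = edges C"
  shows "activates_nicely G (seed S) C"
    and "l \<le> card (span_verts S)"
proof -
  have sub: "edges C \<subseteq> span_edges S"
    using mod2_sum_subset[of "\<lambda>i. edges (Ds ! i)" S] C(3) by (simp add: span_edges_def)
  have "\<Union>(span_edges S) \<subseteq> span_verts S"
    using triangle_simple(1) S_lt by (fastforce simp: span_edges_def span_verts_def)
  then have V: "verts C \<subseteq> span_verts S"
    using verts_cycle_subset[OF C(1)] sub by blast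
  then show "l \<le> card (span_verts S)"
    using card_mono[OF finite_span_verts[OF S]] card_verts_cycle[OF C(1)] by metis
  have "verts (final_graph (seed S) (subprocess S)) = span_verts S"
    by (simp add: final_graph_def verts_stage_subprocess)
  then have "subgraph C (final_graph (seed S) (subprocess S))"
    using V sub C(2) by (simp add: subgraph_def edges_final_subprocess)
  then show "activates_nicely G (seed S) C"
    unfolding activates_nicely_def activates_via_def
    using activation_process_subprocess[OF G] nice_subprocess[OF C(3)] by blast
qed

end

end

section \<open>Small fillings of short cycles\<close>

context triangle_sequence
begin

text \<open>The number \<open>a\<close> bounds the vertices spanned by a filling, which are the vertices of the graph that
  activates \<open>E\<close>.\<close>

definition fillable :: "real \<Rightarrow> 'a set set \<Rightarrow> bool" where
  "fillable a E \<longleftrightarrow>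
    (\<exists>S\<subseteq>{..<length Ds}. triangle_boundary S = E \<and> real (card (span_verts S)) \<le> a)"

lemma fillable_empty: "fillable 0 {}"
  unfolding fillable_def by (intro exI[of _ "{}"]) (simp add: span_verts_def)

lemma fillable_mono: "fillable a E \<Longrightarrow> a \<le> b \<Longrightarrow> fillable b E"
  unfolding fillable_def by (elim exE conjE) (intro exI conjI, assumption, assumption, rule order_trans)

lemma fillable_sym_diff:
  assumes "fillable a E" "fillable b F"
  shows "fillable (a + b) (sym_diff E F)"
proof -
  obtain S where S: "S \<subseteq> {..<length Ds}" "triangle_boundary S = E" "real (card (span_verts S)) \<le> a"
    using assms(1) unfolding fillable_def by (elim exE conjE)
  obtain R where R: "R \<subseteq> {..<length Ds}" "triangle_boundary R = F" "real (card (span_verts R)) \<le> b"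
    using assms(2) unfolding fillable_def by (elim exE conjE)
  let ?Q = "sym_diff S R"
  have Q: "?Q \<subseteq> {..<length Ds}" using S(1) R(1) by (intro Un_least) (rule order_trans[OF Diff_subset], assumption)+
  have "triangle_boundary ?Q = sym_diff E F"
    by (simp only: mod2_sum_sym_diff[OF finite_index[OF S(1)] finite_index[OF R(1)]] S(2) R(2))
  moreover have "span_verts ?Q \<subseteq> span_verts S \<union> span_verts R"
    by (auto simp: span_verts_def)
  then have "card (span_verts ?Q) \<le> card (span_verts S \<union> span_verts R)"
    using finite_span_verts[OF S(1)] finite_span_verts[OF R(1)] by (intro card_mono) simp_all
  then have "card (span_verts ?Q) \<le> card (span_verts S) + card (span_verts R)"
    by (rule order_trans[OF _ card_Un_le])
  then have "real (card (span_verts ?Q)) \<le> a + b"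
    using S(3) R(3) by linarith
  ultimately show ?thesis using Q unfolding fillable_def by (intro exI[of _ ?Q] conjI)
qed

lemma fillable_triangle:
  assumes "i < length Ds"
  shows "fillable 3 (edges (Ds ! i))"
  unfolding fillable_def using assms card_verts_cycle[OF triangle[OF assms]]
  by (intro exI[of _ "{i}"]) (simp add: span_verts_def)

text \<open>A bound proportional to the length passes from cycles to even sets, because the lengths in a
  decomposition add up to the size of the set.\<close>

lemma fillable_of_cycles:
  assumes F: "F \<subseteq> edges G" and G: "simple_graph G"
    and cyc: "\<And>l C. is_cycle l C \<Longrightarrow> edges C \<subseteq> F \<Longrightarrow> l \<le> m \<Longrightarrow> fillable (c * real l) (edges C)"
    and E: "finite E" "E \<subseteq> F" "vertex_boundary E = {}" "card E \<le> m"
  shows "fillable (c * real (card E)) E"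
proof -
  have two: "\<forall>e\<in>E. card e = 2"
    using E(2) F G unfolding simple_graph_def by blast
  have "E \<subseteq> F \<longrightarrow> card E \<le> m \<longrightarrow> fillable (c * real (card E)) E"
    using E(1) two E(3)
  proof (induction rule: cycle_decomposition_induct)
    case empty
    show ?case using fillable_empty by simp
  next
    case (cycle l C E)
    show ?case
    proof (intro impI)
      assume EF: "E \<subseteq> F" "card E \<le> m"
      have l: "card (edges C) = l" using card_edges_cycle[OF cycle(1)] .
      have le: "card (E - edges C) + l = card E"
        using card_Diff_subset[OF finite_edges_cycle[OF cycle(1)] cycle(3)]
          card_mono[OF cycle(2,3)] l by linarith
      have "fillable (c * real l) (edges C)"
        using EF cycle(3) le by (intro cyc[OF cycle(1)]) auto
      moreover have "E - edges C \<subseteq> F" using EF(1) by blast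
      then have "fillable (c * real (card (E - edges C))) (E - edges C)"
        using cycle(4) EF(2) le by simp
      ultimately have "fillable (c * real l + c * real (card (E - edges C)))
          (sym_diff (edges C) (E - edges C))"
        by (rule fillable_sym_diff)
      moreover have "sym_diff (edges C) (E - edges C) = E"
        using cycle(3) by auto
      moreover have "c * real l + c * real (card (E - edges C)) = c * real (card E)"
        using le by (simp add: distrib_left[symmetric] flip: of_nat_add)
      ultimately show "fillable (c * real (card E)) E" by simp
    qed
  qed
  then show ?thesis using E by blast
qed

end

text \<open>The initial tree enters through two properties: it contains no nonempty even set, which starts the
  induction, and any two vertices are joined by a short walk in it, which is available at every stage
  for cutting long cycles.\<close>

locale tree_process = triangle_sequence +
  fixes T :: "'a ugraph"
  assumes simple_G: "simple_graph G" and tree: "is_tree T"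
    and T_sub: "subgraph T G" and T_spans: "verts T = verts G"
    and stage_Suc: "i < length Ds \<Longrightarrow>
      edges (stage T Ds (Suc i)) = insert (new i) (edges (stage T Ds i))"
    and new_notin: "i < length Ds \<Longrightarrow> new i \<notin> edges (stage T Ds i)"
begin

lemma stage_sub_G:
  assumes "i \<le> length Ds"
  shows "edges (stage T Ds i) \<subseteq> edges G"
proof -
  have "edges (Ds ! j) \<subseteq> edges G" if "j < i" for j
    using triangle_simple(3)[of j] that assms by auto
  then show ?thesis
    unfolding edges_stage[OF assms] using T_sub by (auto simp: subgraph_def)
qed

lemma finite_edges_G: "finite (edges G)"
proof -
  have "edges G \<subseteq> Pow (verts G)" "finite (verts G)" using simple_G by (auto simp: simple_graph_def)
  then show ?thesis using finite_subset by blast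
qed

lemma cycle_subgraph_G:
  assumes "is_cycle l C" "edges C \<subseteq> edges G"
  shows "subgraph C G"
proof -
  have e: "e \<subseteq> verts C \<and> card e = 2" if eC: "e \<in> edges C" for e
  proof
    show "card e = 2" using eC assms(2) simple_G by (auto simp: simple_graph_def)
    obtain vs where "distinct vs" and vs: "length vs = l" "verts C = set vs" "e = {vs ! (l - 1), vs ! 0}"
      and "edges C = insert e {{vs ! i, vs ! Suc i} |i. i < l - 1}"
      by (rule cycle_starting_after_edge[OF assms(1) eC])
    then show "e \<subseteq> verts C" using cycle_length_ge[OF assms(1)] by simp
  qed
  have "\<Union>(edges C) \<subseteq> verts G" using assms(2) simple_G by (auto simp: simple_graph_def)
  then have "verts C \<subseteq> verts G" using verts_cycle_subset[OF assms(1)] by (rule order_trans[rotated])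
  moreover have "finite (verts G)" using simple_G by (simp add: simple_graph_def)
  ultimately show ?thesis
    using e assms(2) finite_subset unfolding subgraph_def simple_graph_def by blast
qed

lemma tree_path:
  assumes "u \<in> verts G" "v \<in> verts G"
  obtains P where "P \<subseteq> edges T" "finite P" "card P \<le> graph_diameter T"
    "vertex_boundary P = sym_diff {u} {v}"
proof -
  have "u \<in> verts T" "v \<in> verts T" using assms T_spans by simp_all
  then obtain k where k: "k \<le> graph_diameter T" "(u, v) \<in> adj_rel T ^^ k"
    by (rule relpow_le_diameter[OF tree])
  have "simple_graph T" using tree by (simp add: is_tree_def)
  from vertex_boundary_walk[OF k(2) this]
  obtain P where P: "P \<subseteq> edges T" "finite P" "card P \<le> k" "vertex_boundary P = sym_diff {u} {v}"
    by (elim exE conjE)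
  show thesis using that[OF P(1,2) _ P(4)] P(3) k(1) by simp
qed

lemma even_in_tree:
  assumes "E \<subseteq> edges T" "vertex_boundary E = {}"
  shows "E = {}"
proof (rule ccontr)
  assume "E \<noteq> {}"
  have TG: "edges T \<subseteq> edges G" using T_sub by (simp add: subgraph_def)
  have "finite E" using assms(1) TG finite_edges_G by (meson finite_subset)
  moreover have "card e = 2" if "e \<in> E" for e
    using that assms(1) TG simple_G by (auto simp: simple_graph_def)
  ultimately obtain l C where C: "is_cycle l C" "edges C \<subseteq> E"
    using even_edge_set_contains_cycle[OF _ _ assms(2) \<open>E \<noteq> {}\<close>] by blast
  have "edges C \<subseteq> edges T" using C(2) assms(1) by (rule order_trans)
  moreover have "subgraph C G" using cycle_subgraph_G[OF C(1)] calculation TG by (meson order_trans)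
  ultimately have "subgraph C T" using T_spans by (simp add: subgraph_def)
  then show False using C(1) tree by (auto simp: is_tree_def)
qed

text \<open>Adding the \<open>i\<close>-th triangle to \<open>F\<close> exchanges the activated edge for at most two edges that are
  present at stage \<open>i\<close>. The last summand 3 counts the vertices of the triangle.\<close>

lemma even_triangle_swap:
  assumes i: "i < length Ds"
    and F: "F \<subseteq> edges (stage T Ds (Suc i))" "new i \<in> F" "vertex_boundary F = {}"
    and IH: "\<And>E. E \<subseteq> edges (stage T Ds i) \<Longrightarrow> vertex_boundary E = {} \<Longrightarrow> card E \<le> m \<Longrightarrow>
      fillable (c * real (card E)) E"
    and m: "card F < m" and c: "c \<ge> 0"
  shows "fillable (c * real (Suc (card F)) + 3) F"
proof -
  let ?D = "edges (Ds ! i)"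
  let ?E = "sym_diff F ?D"
  have "edges (stage T Ds (Suc i)) = edges (stage T Ds i) \<union> ?D"
    using edges_stage[of "Suc i" Ds T] edges_stage[of i Ds T] i by (auto simp: less_Suc_eq)
  then have D: "?D \<subseteq> insert (new i) (edges (stage T Ds i))" using stage_Suc[OF i] by auto
  have newD: "new i \<in> ?D" using new_in[OF i] .
  have finF: "finite F" using F(1) stage_sub_G[of "Suc i"] i finite_edges_G
    by (meson Suc_leI finite_subset order_trans)
  have finD: "finite ?D" using finite_edges_cycle[OF triangle[OF i]] .
  have sub: "?E \<subseteq> edges (stage T Ds i)"
    using D newD F(1,2) unfolding stage_Suc[OF i] by auto
  have "card (F - {new i}) = card F - 1" "card (?D - {new i}) = 2" "card F > 0"
    using finF finD F(2) newD card_edges_cycle[OF triangle[OF i]] by (auto simp: card_gt_0_iff)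
  moreover have "card ?E \<le> card (F - {new i}) + card (?D - {new i})"
  proof -
    have "?E \<subseteq> (F - {new i}) \<union> (?D - {new i})" using F(2) newD by auto
    then have "card ?E \<le> card ((F - {new i}) \<union> (?D - {new i}))"
      using finF finD by (intro card_mono) simp_all
    then show ?thesis by (rule order_trans[OF _ card_Un_le])
  qed
  ultimately have cE: "card ?E \<le> Suc (card F)" by linarith
  have "vertex_boundary ?E = {}"
    by (simp only: mod2_sum_sym_diff[OF finF finD] F(3) vertex_boundary_cycle[OF triangle[OF i]]) simp
  then have "fillable (c * real (card ?E)) ?E" using IH[OF sub] cE m by simp
  then have "fillable (c * real (card ?E) + 3) (sym_diff ?E ?D)"
    using fillable_triangle[OF i] by (rule fillable_sym_diff)
  moreover have "sym_diff ?E ?D = F" by auto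
  ultimately have "fillable (c * real (card ?E) + 3) F" by simp
  then show ?thesis
    by (rule fillable_mono) (intro add_right_mono mult_left_mono of_nat_mono cE c)
qed

text \<open>A cycle shorter than \<open>2 D + 2\<close>, where \<open>D\<close> is the diameter of the tree, can afford the additional
  edge of \<open>even_triangle_swap\<close>. A cycle of length \<open>2 D + 2\<close> is cut by a tree path of length at most
  \<open>D\<close> into two even sets with at most \<open>2 D + 1\<close> edges, only one of which contains the activated edge.\<close>

lemma cycle_through_new_edge:
  assumes i: "i < length Ds" and C: "is_cycle l C" "edges C \<subseteq> edges (stage T Ds (Suc i))"
    and new: "new i \<in> edges C" and l: "l \<le> 2 * graph_diameter T + 2" and D1: "graph_diameter T \<ge> 1"
    and IH: "\<And>E. E \<subseteq> edges (stage T Ds i) \<Longrightarrow> vertex_boundary E = {} \<Longrightarrow>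
      card E \<le> 2 * graph_diameter T + 2 \<Longrightarrow> fillable (c * real (card E)) E"
    and c: "c \<ge> 0"
  shows "fillable (3 + c * (2 * real l)) (edges C)"
proof (cases "l < 2 * graph_diameter T + 2")
  case True
  have "fillable (c * real (Suc (card (edges C))) + 3) (edges C)"
    using True card_edges_cycle[OF C(1)]
    by (intro even_triangle_swap[OF i C(2) new vertex_boundary_cycle[OF C(1)] IH _ c]) simp_all
  moreover have "c * real (Suc l) \<le> c * (2 * real l)"
    using cycle_length_ge[OF C(1)] c by (intro mult_left_mono) simp_all
  ultimately show ?thesis
    using card_edges_cycle[OF C(1)] by (auto elim: fillable_mono)
next
  case False
  define d where "d = graph_diameter T"
  have ld: "l = 2 * d + 2" using l False by (simp add: d_def)
  obtain vs where vs: "distinct vs" "length vs = l" "verts C = set vs"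
      "new i = {vs ! (l - 1), vs ! 0}" and E: "edges C = insert (new i) {{vs ! i, vs ! Suc i} |i. i < l - 1}"
    by (rule cycle_starting_after_edge[OF C(1) new])
  \<comment> \<open>an arc with \<open>d + 1\<close> edges that avoids the activated edge; the rest of the cycle has \<open>d + 1\<close> edges, too\<close>
  let ?A = "{{vs ! i, vs ! Suc i} |i. i < Suc d}"
  have lt: "Suc d < length vs" using vs(2) ld by simp
  have l3: "l \<ge> 3" using cycle_length_ge[OF C(1)] .
  have finC: "finite (edges C)" using finite_edges_cycle[OF C(1)] .
  have AC: "?A \<subseteq> edges C" unfolding E using ld by fastforce
  have "{{vs ! i, vs ! Suc i} |i. i < Suc d} \<subseteq> {{vs ! i, vs ! Suc i} |i. i < l - 1}"
    using ld by fastforce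
  then have newA: "new i \<notin> ?A"
    using closing_edge_notin_arc[OF vs(1,2) l3] unfolding vs(4) by (rule contra_subsetD)
  have "set vs \<subseteq> verts G"
    using cycle_subgraph_G[OF C(1)] C(2) stage_sub_G[of "Suc i"] i vs(3) by (auto simp: subgraph_def)
  then have ends: "vs ! 0 \<in> verts G" "vs ! Suc d \<in> verts G"
    using nth_mem[of 0 vs] nth_mem[OF lt] order_le_less_trans[OF le0 lt] by blast+
  obtain P where P: "P \<subseteq> edges T" "finite P" "card P \<le> d" "vertex_boundary P = sym_diff {vs ! 0} {vs ! Suc d}"
    unfolding d_def[symmetric] using tree_path[OF ends] d_def by metis
  have PS: "P \<subseteq> edges (stage T Ds i)" using P(1) edges_stage[of i Ds T] i by auto
  then have newP: "new i \<notin> P" using new_notin[OF i] by blast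
  let ?E1 = "sym_diff ?A P"
  let ?E2 = "sym_diff (edges C) ?E1"
  have finA: "finite ?A" by simp
  have finE1: "finite ?E1" using P(2) by simp
  have b1: "vertex_boundary ?E1 = {}"
    by (simp only: mod2_sum_sym_diff[OF finA P(2)] vertex_boundary_arc[OF vs(1) lt] P(4)) simp
  have b2: "vertex_boundary ?E2 = {}"
    by (simp only: mod2_sum_sym_diff[OF finC finE1] b1 vertex_boundary_cycle[OF C(1)]) simp
  have cA: "card ?A = Suc d" using card_arc[OF vs(1) lt] .
  have c1: "card ?E1 \<le> 2 * d + 1"
    using card_sym_diff_le[OF finA P(2)] P(3) cA by linarith
  have "card (edges C - ?A) = d + 1"
    using card_Diff_subset[OF finA AC] cA card_edges_cycle[OF C(1)] ld by simp
  moreover have "?E2 \<subseteq> (edges C - ?A) \<union> P" using AC by auto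
  then have "card ?E2 \<le> card ((edges C - ?A) \<union> P)"
    using finC P(2) by (intro card_mono) simp_all
  then have "card ?E2 \<le> card (edges C - ?A) + card P"
    by (rule order_trans[OF _ card_Un_le])
  ultimately have c2: "card ?E2 \<le> 2 * d + 1" using P(3) by linarith
  have "?A \<subseteq> edges (stage T Ds i)"
    using AC C(2) newA unfolding stage_Suc[OF i] by blast
  then have "?E1 \<subseteq> edges (stage T Ds i)" using PS by blast
  then have f1: "fillable (c * real (card ?E1)) ?E1"
    using b1 c1 by (intro IH) (simp_all add: d_def)
  have E2: "?E2 \<subseteq> edges (stage T Ds (Suc i))"
    using C(2) AC PS stage_Suc[OF i] by blast
  have newE2: "new i \<in> ?E2" using new newA newP by blast
  have c2': "card ?E2 < 2 * graph_diameter T + 2" using c2 unfolding d_def by linarith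
  have f2: "fillable (c * real (Suc (card ?E2)) + 3) ?E2"
    by (rule even_triangle_swap[OF i E2 newE2 b2 IH c2' c])
  have "sym_diff ?E1 ?E2 = edges C" by auto
  then have "fillable (c * real (card ?E1) + (c * real (Suc (card ?E2)) + 3)) (edges C)"
    using fillable_sym_diff[OF f1 f2] by (simp only:)
  moreover have "c * real (card ?E1) + (c * real (Suc (card ?E2)) + 3) \<le> 3 + c * (2 * real l)"
  proof -
    have "real (card ?E1) + real (Suc (card ?E2)) \<le> 2 * real l"
      using c1 c2 ld by linarith
    then have "c * (real (card ?E1) + real (Suc (card ?E2))) \<le> c * (2 * real l)"
      using c by (rule mult_left_mono)
    then show ?thesis by (simp only: distrib_left)
  qed
  ultimately show ?thesis by (rule fillable_mono)
qed

text \<open>The swap and the cut cost a factor of about 2 in the size of the filling. Without \<open>gap\<close> these factors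
  would accumulate along the process; with it the bound is restored after every step.\<close>

lemma even_sets_fillable:
  assumes D1: "graph_diameter T \<ge> 1" and c: "c \<ge> 0"
    and gap: "\<And>l C. is_cycle l C \<Longrightarrow> subgraph C G \<Longrightarrow> l \<le> 2 * graph_diameter T + 2 \<Longrightarrow>
      fillable (3 + c * (2 * real l)) (edges C) \<Longrightarrow> fillable (c * real l) (edges C)"
    and "i \<le> length Ds" "E \<subseteq> edges (stage T Ds i)" "vertex_boundary E = {}"
      "card E \<le> 2 * graph_diameter T + 2"
  shows "fillable (c * real (card E)) E"
  using assms(4-7)
proof (induction i arbitrary: E)
  case 0
  then have "E = {}" by (intro even_in_tree) (simp_all add: stage_def)
  then show ?case using fillable_empty by simp
next
  case (Suc i)
  then have i: "i < length Ds" by simp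
  have SG: "edges (stage T Ds (Suc i)) \<subseteq> edges G" using stage_sub_G Suc.prems(1) .
  have IH: "fillable (c * real (card F)) F"
    if "F \<subseteq> edges (stage T Ds i)" "vertex_boundary F = {}" "card F \<le> 2 * graph_diameter T + 2" for F
    using Suc.IH that i by simp
  have cycles: "fillable (c * real l) (edges C)"
    if C: "is_cycle l C" "edges C \<subseteq> edges (stage T Ds (Suc i))" "l \<le> 2 * graph_diameter T + 2" for l C
  proof (cases "new i \<in> edges C")
    case True
    have CG: "subgraph C G" using C(1) order_trans[OF C(2) SG] by (rule cycle_subgraph_G)
    have "fillable (3 + c * (2 * real l)) (edges C)"
      using cycle_through_new_edge[OF i C(1,2) True C(3) D1 IH c] .
    then show ?thesis by (rule gap[OF C(1) CG C(3)])
  next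
    case False
    then have "edges C \<subseteq> edges (stage T Ds i)"
      using C(2)[unfolded stage_Suc[OF i]] by (rule iffD1[OF subset_insert])
    then show ?thesis
      using IH[OF _ vertex_boundary_cycle[OF C(1)]] C(3) card_edges_cycle[OF C(1)] by simp
  qed
  have "finite E" using Suc.prems(2) SG finite_edges_G by (meson finite_subset)
  then show ?case
  proof (rule fillable_of_cycles[OF SG simple_G _ _ Suc.prems(2-4), rotated])
    fix l C assume "is_cycle l C" "edges C \<subseteq> edges (stage T Ds (Suc i))" "l \<le> 2 * graph_diameter T + 2"
    then show "fillable (c * real l) (edges C)" by (rule cycles)
  qed
qed

end

section \<open>The contradiction at length 4\<close>

lemma tree_process_of_activation:
  assumes G: "simple_graph G" and T: "spanning_tree T G" and proc: "activation_process G T Ds"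
  obtains new where "tree_process G Ds new T"
proof -
  let ?P = "\<lambda>i e. e \<notin> edges (stage T Ds i) \<and> edges (stage T Ds (Suc i)) = insert e (edges (stage T Ds i))"
  define new where "new i = (SOME e. ?P i e)" for i
  have ex: "\<exists>e. ?P i e" if "i < length Ds" for i
    using proc that unfolding activation_process_def by (elim conjE) (drule spec, drule (1) mp, erule conjunct2)
  have new: "new i \<notin> edges (stage T Ds i)"
    "edges (stage T Ds (Suc i)) = insert (new i) (edges (stage T Ds i))" if "i < length Ds" for i
    using someI_ex[OF ex[OF that]] unfolding new_def by blast+
  have D: "is_cycle 3 (Ds ! i)" "subgraph (Ds ! i) G" if "i < length Ds" for i
    using proc that unfolding activation_process_def by simp_all
  have "tree_process G Ds new T"
  proof unfold_locales
    fix i assume i: "i < length Ds"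
    show "is_cycle 3 (Ds ! i)" "subgraph (Ds ! i) G" using D[OF i] .
    show "new i \<notin> edges (stage T Ds i)"
      "edges (stage T Ds (Suc i)) = insert (new i) (edges (stage T Ds i))" using new[OF i] .
    have "edges (stage T Ds (Suc i)) = edges (stage T Ds i) \<union> edges (Ds ! i)"
      using edges_stage[of "Suc i" Ds T] edges_stage[of i Ds T] i by (auto simp: less_Suc_eq)
    then show "new i \<in> edges (Ds ! i)" using new[OF i] by blast
    fix j assume j: "j < length Ds" "new i \<in> edges (Ds ! j)"
    show "i \<le> j"
    proof (rule ccontr)
      assume "\<not> i \<le> j"
      then have "new i \<in> edges (stage T Ds i)" using edges_stage[of i Ds T] i j(2) by auto
      then show False using new(1)[OF i] by simp
    qed
  next
    show "simple_graph G" using G .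
    show "is_tree T" "subgraph T G" "verts T = verts G" using T by (simp_all add: spanning_tree_def)
  qed
  then show thesis by (rule that)
qed

lemma diameter_pos:
  assumes "is_tree T" "card (verts T) \<ge> 2"
  shows "graph_diameter T \<ge> 1"
proof -
  have "\<not> card (verts T) \<le> Suc 0" "finite (verts T)"
    using assms by (auto simp: is_tree_def simple_graph_def)
  then obtain u v where uv: "u \<in> verts T" "v \<in> verts T" "u \<noteq> v"
    using card_le_Suc0_iff_eq by blast
  obtain k where "k \<le> graph_diameter T" "(u, v) \<in> adj_rel T ^^ k"
    by (rule relpow_le_diameter[OF assms(1) uv(1,2)])
  then show ?thesis using uv(3) by (cases k) auto
qed

lemma half_le_ln:
  assumes "n \<ge> (2::nat)"
  shows "1 / 2 \<le> ln (real n)"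
proof -
  have "1 / 2 \<le> ln (2::real)" using ln_le_minus_one[of "1 / 2"] by (simp add: ln_div)
  also have "\<dots> \<le> ln (real n)" using assms by simp
  finally show ?thesis .
qed

theorem proposition5p18:
  fixes G :: "'a ugraph" and n L K K1 K2 :: nat
  assumes "n \<ge> 2" and "L > 0" and "K1 > 0" and "K > 100 * K1" and "K2 > K"
    and "simple_graph G" and "card (verts G) = n"
    and L1: "\<And>l. 3 \<le> l \<Longrightarrow> l \<le> L \<Longrightarrow>
      \<not> (\<exists>H C. subgraph H G \<and> subgraph C G \<and> connected_graph H \<and> is_cycle l C \<and>
             real (card (verts H)) \<in> {real K1 * real l * ln (real n) .. real K2 * real l * ln (real n)} \<and>
             activates_nicely G H C)"
    and L2: "\<And>l. 4 \<le> l \<Longrightarrow> l \<le> L \<Longrightarrow>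
      \<exists>C. subgraph C G \<and> is_cycle l C \<and>
          \<not> (\<exists>H. subgraph H G \<and> connected_graph H \<and>
                 real (card (verts H)) \<in> {real l .. real K * real l * ln (real n)} \<and>
                 activates_nicely G H C)"
  shows "\<not> (\<exists>T. subgraph T G \<and> is_tree T \<and>
                real (graph_diameter T) \<le> real L / 100 \<and> tree_activates T G)"
proof (intro notI, elim exE conjE)
  fix T assume tree: "is_tree T" and diam: "real (graph_diameter T) \<le> real L / 100"
    and "tree_activates T G"
  then obtain Ds where T: "spanning_tree T G" and Ds: "activation_process G T Ds" "final_graph T Ds = G"
    unfolding tree_activates_def by (elim conjE exE)
  obtain new where "tree_process G Ds new T"
    by (rule tree_process_of_activation[OF \<open>simple_graph G\<close> T Ds(1)])
  then interpret tree_process G Ds new T .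
  define D where "D = graph_diameter T"
  have "card (verts T) \<ge> 2" using T assms(1,7) by (simp add: spanning_tree_def)
  then have D1: "D \<ge> 1" unfolding D_def by (rule diameter_pos[OF tree])
  have DL: "2 * D + 2 \<le> L" using diam D1 unfolding D_def[symmetric] by linarith
  have ln: "1 / 2 \<le> ln (real n)" using half_le_ln[OF assms(1)] .
  define c where "c = real K1 * ln (real n)"
  have c: "c \<ge> 1 / 2"
    using mult_mono[of 1 "real K1" "1 / 2" "ln (real n)"] assms(3) ln by (simp add: c_def)
  have gap: "fillable (c * real l) (edges C)"
    if C: "is_cycle l C" "subgraph C G" "l \<le> 2 * D + 2"
      and fill: "fillable (3 + c * (2 * real l)) (edges C)" for l C
  proof -
    obtain S where S: "S \<subseteq> {..<length Ds}" "triangle_boundary S = edges C"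
      "real (card (span_verts S)) \<le> 3 + c * (2 * real l)"
      using fill unfolding fillable_def by (elim exE conjE)
    have l3: "l \<ge> 3" using cycle_length_ge[OF C(1)] .
    \<comment> \<open>the bound \<open>c \<ge> 1 / 2\<close> absorbs the vertices of the last triangle\<close>
    have "3 \<le> c * (2 * real l)"
      using mult_mono[of "1 / 2" c 6 "2 * real l"] c l3 by simp
    then have "real (card (span_verts S)) \<le> 4 * (c * real l)" using S(3) by simp
    also have "\<dots> \<le> real K2 * real l * ln (real n)"
    proof -
      have "4 * real K1 \<le> real K2" using assms(4,5) by linarith
      then have "4 * real K1 * (real l * ln (real n)) \<le> real K2 * (real l * ln (real n))"
        using ln by (intro mult_right_mono) simp_all
      then show ?thesis by (simp add: c_def mult_ac)
    qed
    finally have upper: "real (card (verts (seed S))) \<le> real K2 * real l * ln (real n)"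
      by (simp add: seed_def)
    have "\<not> real K1 * real l * ln (real n) \<le> real (card (verts (seed S)))"
    proof
      assume "real K1 * real l * ln (real n) \<le> real (card (verts (seed S)))"
      then have "real (card (verts (seed S))) \<in> {real K1 * real l * ln (real n) .. real K2 * real l * ln (real n)}"
        using upper by simp
      note seed = this subgraph_seed[OF S(1) simple_G] seed_connected[OF S(1) C(1) S(2)]
        seed_activates_nicely(1)[OF S(1) simple_G C(1,2) S(2)]
      have "l \<le> L" using C(3) DL by linarith
      from L1[OF l3 this] show False
        by (rule notE) (intro exI[of _ "seed S"] exI[of _ C] conjI seed C(1,2))
    qed
    then have "real (card (span_verts S)) \<le> c * real l"
      by (simp add: seed_def c_def mult_ac)
    then show ?thesis using S(1,2) unfolding fillable_def by (intro exI[of _ S] conjI)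
  qed
  have "4 \<le> L" using DL D1 by linarith
  then obtain C where C: "subgraph C G" "is_cycle 4 C"
    and no: "\<not> (\<exists>H. subgraph H G \<and> connected_graph H \<and>
      real (card (verts H)) \<in> {real 4 .. real K * real 4 * ln (real n)} \<and> activates_nicely G H C)"
    using L2[of 4] by auto
  have "fillable (c * real (card (edges C))) (edges C)"
  proof (rule even_sets_fillable[of c "length Ds"])
    show "edges C \<subseteq> edges (stage T Ds (length Ds))"
      using C(1) Ds(2) by (simp add: subgraph_def final_graph_def)
    show "card (edges C) \<le> 2 * graph_diameter T + 2"
      using card_edges_cycle[OF C(2)] D1 by (simp add: D_def)
  qed (use D1 c gap vertex_boundary_cycle[OF C(2)] in \<open>simp_all add: D_def\<close>)
  then obtain S where S: "S \<subseteq> {..<length Ds}" "triangle_boundary S = edges C"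
    "real (card (span_verts S)) \<le> c * real 4"
    unfolding card_edges_cycle[OF C(2)] fillable_def by (elim exE conjE)
  have "real K1 * (4 * ln (real n)) \<le> real K * (4 * ln (real n))"
    using assms(4) ln by (intro mult_right_mono) simp_all
  then have "real (card (verts (seed S))) \<in> {real 4 .. real K * real 4 * ln (real n)}"
    using S(3) seed_activates_nicely(2)[OF S(1) simple_G C(2,1) S(2)] by (simp add: seed_def c_def mult_ac)
  note seed = this subgraph_seed[OF S(1) simple_G] seed_connected[OF S(1) C(2) S(2)]
    seed_activates_nicely(1)[OF S(1) simple_G C(2,1) S(2)]
  from no show False
    by (rule notE) (intro exI[of _ "seed S"] conjI seed)
qed

end
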